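(* For a finite Markov decision process, let $\alpha\in(0,1)$ be an irregular point. Then (a) if $\liminf_{\beta\uparrow\alpha}N(\beta)<\infty$, then there exists $K\in\mathbb{N}^+$ such that $D_n(\alpha)\cap D(\alpha-)\ne\emptyset$ for all $n\ge K$; (b) if $\liminf_{\beta\downarrow\alpha}N(\beta)<\infty$, then there exists $K\in\mathbb{N}^+$ such that $D_n(\alpha)\cap D(\alpha+)\ne\emptyset$ for all $n\ge K$.
   Context: A finite Markov decision process (MDP) has a finite state set $\mathbb{X}=\{x^1,\ldots,x^m\}$, a finite nonempty action set $A(x)$ for each $x\in\mathbb{X}$, real one-step rewards $r(x,a)$, transition probabilities $p(\cdot|x,a)$ on $\mathbb{X}$, and a terminal reward $s:\mathbb{X}\to\mathbb{R}$. $\mathbb{F}$ is the set of decision rules (identified with deterministic policies), i.e. maps $\phi$ on $\mathbb{X}$ with $\phi(x)\in A(x)$. Functions on $\mathbb{X}$ are identified with vectors in $\mathbb{R}^m$. $P(\phi)$ is the stochastic matrix with entries $p(x^j|x^i,\phi(x^i))$ and $r(\phi)(x)=r(x,\phi(x))$. For $\alpha\in[0,1)$: $v_\alpha^\phi=\sum_{t=0}^\infty\alpha^tP(\phi)^tr(\phi)$; $V_\alpha(x)=\max_{\phi\in\mathbb{F}}v_\alpha^\phi(x)$; $T_\alpha^\phi V=r(\phi)+\alpha P(\phi)V$; $V_{0,\alpha}=s$ and $V_{n,\alpha}(x)=\max_{\phi\in\mathbb{F}}T_\alpha^\phi V_{n-1,\alpha}(x)$ for $n\ge1$. Put $D_n(\alpha)=\{\phi\in\mathbb{F}:V_{n,\alpha}=T_\alpha^\phi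 V_{n-1,\alpha}\}$ for $n\in\mathbb{N}^+=\{1,2,\ldots\}$, $D(\alpha)=\{\phi\in\mathbb{F}:V_\alpha=v_\alpha^\phi\}$, $D(E)=\bigcup_{\alpha\in E}D(\alpha)$ for $E\subset[0,1)$. The turnpike integer $N(\alpha)$ is the smallest positive integer such that $D_n(\alpha)\subset D(\alpha)$ for all $n\ge N(\alpha)$ (it is known to exist). For $\alpha\in(0,1)$ let $D(\alpha-)=\bigcap_{i\ge1}D((\alpha-\frac1i,\alpha)\cap[0,1))$ and $D(\alpha+)=\bigcap_{i\ge1}D((\alpha,\alpha+\frac1i)\cap[0,1))$. A point $\alpha\in(0,1)$ is irregular if $D(\alpha-)\ne D(\alpha+)$ (break point) or $D(\alpha)\ne D(\alpha-)\cup D(\alpha+)$ (touching point). *)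

theory Defs
  imports "HOL-Analysis.Analysis"
begin

text \<open>
  The state space is the whole finite type \<open>'x\<close>, so functions on states are vectors
  \<open>real ^ 'x\<close>. \<open>trans M x a y\<close> is the transition probability \<open>p(y|x,a)\<close>. Rewards and transition
  probabilities are total functions, but only their values at actions \<open>a \<in> actions M x\<close> are ever used.
\<close>

record ('x, 'a) mdp =
  actions :: "'x \<Rightarrow> 'a set"
  reward :: "'x \<Rightarrow> 'a \<Rightarrow> real"
  trans :: "'x \<Rightarrow> 'a \<Rightarrow> 'x \<Rightarrow> real"
  terminal :: "'x \<Rightarrow> real"

definition finite_mdp :: "('x::finite, 'a) mdp \<Rightarrow> bool" where
  "finite_mdp M \<longleftrightarrow>
     (\<forall>x. finite (actions M x) \<and> actions M x \<noteq> {}) \<and>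
     (\<forall>x. \<forall>a\<in>actions M x. (\<forall>y. 0 \<le> trans M x a y) \<and> (\<Sum>y\<in>UNIV. trans M x a y) = 1)"

definition decision_rules :: "('x::finite, 'a) mdp \<Rightarrow> ('x \<Rightarrow> 'a) set" where
  "decision_rules M = {\<phi>. \<forall>x. \<phi> x \<in> actions M x}"

definition trans_mat :: "('x::finite, 'a) mdp \<Rightarrow> ('x \<Rightarrow> 'a) \<Rightarrow> real ^ 'x ^ 'x" where
  "trans_mat M \<phi> = (\<chi> i j. trans M i (\<phi> i) j)"

definition reward_vec :: "('x::finite, 'a) mdp \<Rightarrow> ('x \<Rightarrow> 'a) \<Rightarrow> real ^ 'x" where
  "reward_vec M \<phi> = (\<chi> x. reward M x (\<phi> x))"

text \<open>The power operation of class \<open>power\<close> on \<open>real ^ 'x ^ 'x\<close> is not the matrix power.\<close>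

primrec mat_pow :: "real ^ 'x ^ 'x \<Rightarrow> nat \<Rightarrow> real ^ 'x ^ ('x::finite)" where
  "mat_pow Q 0 = mat 1"
| "mat_pow Q (Suc t) = Q ** mat_pow Q t"

text \<open>
  The discount factor \<open>\<alpha>\<close> is meant to lie in \<open>{0..<1}\<close> in all of the following definitions; the
  series defining \<open>policy_value\<close> converges there.
\<close>

definition policy_value :: "('x::finite, 'a) mdp \<Rightarrow> real \<Rightarrow> ('x \<Rightarrow> 'a) \<Rightarrow> real ^ 'x" where
  "policy_value M \<alpha> \<phi> = (\<Sum>t. \<alpha> ^ t *\<^sub>R (mat_pow (trans_mat M \<phi>) t *v reward_vec M \<phi>))"

definition opt_value :: "('x::finite, 'a) mdp \<Rightarrow> real \<Rightarrow> real ^ 'x" where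
  "opt_value M \<alpha> = (\<chi> x. Max ((\<lambda>\<phi>. policy_value M \<alpha> \<phi> $ x) ` decision_rules M))"

definition T_op :: "('x::finite, 'a) mdp \<Rightarrow> real \<Rightarrow> ('x \<Rightarrow> 'a) \<Rightarrow> real ^ 'x \<Rightarrow> real ^ 'x" where
  "T_op M \<alpha> \<phi> V = reward_vec M \<phi> + \<alpha> *\<^sub>R (trans_mat M \<phi> *v V)"

primrec fin_value :: "('x::finite, 'a) mdp \<Rightarrow> real \<Rightarrow> nat \<Rightarrow> real ^ 'x" where
  "fin_value M \<alpha> 0 = (\<chi> x. terminal M x)"
| "fin_value M \<alpha> (Suc n) =
     (\<chi> x. Max ((\<lambda>\<phi>. T_op M \<alpha> \<phi> (fin_value M \<alpha> n) $ x) ` decision_rules M))"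

text \<open>\<open>D\<^sub>n(\<alpha>)\<close>; meaningful for \<open>n \<ge> 1\<close> only.\<close>

definition D_fin :: "('x::finite, 'a) mdp \<Rightarrow> nat \<Rightarrow> real \<Rightarrow> ('x \<Rightarrow> 'a) set" where
  "D_fin M n \<alpha> =
     {\<phi> \<in> decision_rules M. fin_value M \<alpha> n = T_op M \<alpha> \<phi> (fin_value M \<alpha> (n - 1))}"

definition D_opt :: "('x::finite, 'a) mdp \<Rightarrow> real \<Rightarrow> ('x \<Rightarrow> 'a) set" where
  "D_opt M \<alpha> = {\<phi> \<in> decision_rules M. opt_value M \<alpha> = policy_value M \<alpha> \<phi>}"

definition D_set :: "('x::finite, 'a) mdp \<Rightarrow> real set \<Rightarrow> ('x \<Rightarrow> 'a) set" where
  "D_set M E = (\<Union>\<alpha>\<in>E. D_opt M \<alpha>)"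

definition D_left :: "('x::finite, 'a) mdp \<Rightarrow> real \<Rightarrow> ('x \<Rightarrow> 'a) set" where
  "D_left M \<alpha> = (\<Inter>i\<in>{1::nat..}. D_set M ({\<alpha> - 1 / real i <..< \<alpha>} \<inter> {0..<1}))"

definition D_right :: "('x::finite, 'a) mdp \<Rightarrow> real \<Rightarrow> ('x \<Rightarrow> 'a) set" where
  "D_right M \<alpha> = (\<Inter>i\<in>{1::nat..}. D_set M ({\<alpha> <..< \<alpha> + 1 / real i} \<inter> {0..<1}))"

text \<open>
  The set of admissible \<open>N\<close> is nonempty for every finite MDP and every \<open>\<alpha> \<in> {0..<1}\<close>, so the
  \<open>LEAST\<close> is a genuine minimum there.
\<close>

definition turnpike :: "('x::finite, 'a) mdp \<Rightarrow> real \<Rightarrow> nat" where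
  "turnpike M \<alpha> = (LEAST N. 1 \<le> N \<and> (\<forall>n\<ge>N. D_fin M n \<alpha> \<subseteq> D_opt M \<alpha>))"

definition break_point :: "('x::finite, 'a) mdp \<Rightarrow> real \<Rightarrow> bool" where
  "break_point M \<alpha> \<longleftrightarrow> 0 < \<alpha> \<and> \<alpha> < 1 \<and> D_left M \<alpha> \<noteq> D_right M \<alpha>"

definition touching_point :: "('x::finite, 'a) mdp \<Rightarrow> real \<Rightarrow> bool" where
  "touching_point M \<alpha> \<longleftrightarrow> 0 < \<alpha> \<and> \<alpha> < 1 \<and> D_opt M \<alpha> \<noteq> D_left M \<alpha> \<union> D_right M \<alpha>"

definition irregular_point :: "('x::finite, 'a) mdp \<Rightarrow> real \<Rightarrow> bool" where
  "irregular_point M \<alpha> \<longleftrightarrow> break_point M \<alpha> \<or> touching_point M \<alpha>"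

end

theory Submission
  imports Defs
begin

text \<open>
  If the turnpike integers \<open>N(\<beta>)\<close> stay below some \<open>K\<close> along a sequence \<open>\<beta> \<rightarrow> \<alpha>\<close> from one side, then
  for \<open>n \<ge> K\<close> every maximising rule of stage \<open>n\<close> at such a \<open>\<beta>\<close> is optimal at \<open>\<beta>\<close>. There are finitely
  many rules, so one of them recurs along the sequence; it belongs to the one-sided limit set, and
  since \<open>V\<^sub>n\<^sub>,\<^sub>\<beta>\<close> is continuous in \<open>\<beta>\<close> it also belongs to \<open>D\<^sub>n(\<alpha>)\<close>. For the bound on \<open>N(\<beta>)\<close> to carry any
  information, the turnpike integer has to exist; this follows from the convergence of value
  iteration to the unique fixed point of the Bellman operator.
\<close>

section \<open>Banach's fixed point theorem for the sup norm\<close>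

lemma contraction_infnorm_fixpoint:
  fixes F :: "real ^ 'x \<Rightarrow> real ^ ('x::finite)"
  assumes b: "0 \<le> b" "b < 1"
    and F: "\<And>U V. infnorm (F U - F V) \<le> b * infnorm (U - V)"
  obtains W where "F W = W" "\<And>V. (\<lambda>n. (F ^^ n) V) \<longlonglongrightarrow> W"
proof -
  have le: "infnorm ((F ^^ n) U - (F ^^ n) V) \<le> b ^ n * infnorm (U - V)" for n U V
  proof (induction n)
    case (Suc n)
    have "infnorm ((F ^^ Suc n) U - (F ^^ Suc n) V) \<le> b * infnorm ((F ^^ n) U - (F ^^ n) V)"
      using F by simp
    also have "\<dots> \<le> b * (b ^ n * infnorm (U - V))"
      using Suc b by (intro mult_left_mono)
    finally show ?case by (simp add: mult_ac)
  qed simp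
  \<comment> \<open>\<open>C\<close> bounds the Euclidean norm by the sup norm. \<open>F\<close>
    itself may fail to contract the Euclidean norm, but its iterates still approach each other
    geometrically there.\<close>
  define C where "C = sqrt (real DIM(real ^ 'x))"
  have norm_le: "norm ((F ^^ n) U - (F ^^ n) V) \<le> C * infnorm (U - V) * b ^ n" for n U V
  proof -
    have "norm ((F ^^ n) U - (F ^^ n) V) \<le> C * infnorm ((F ^^ n) U - (F ^^ n) V)"
      unfolding C_def by (rule norm_le_infnorm)
    also have "\<dots> \<le> C * (b ^ n * infnorm (U - V))"
      using le by (intro mult_left_mono) (auto simp: C_def)
    finally show ?thesis by (simp add: mult_ac)
  qed
  have diff0: "(\<lambda>n. (F ^^ n) U - (F ^^ n) V) \<longlonglongrightarrow> 0" for U V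
  proof (rule Lim_null_comparison)
    show "\<forall>\<^sub>F n in sequentially. norm ((F ^^ n) U - (F ^^ n) V) \<le> C * infnorm (U - V) * b ^ n"
      using norm_le by simp
    show "(\<lambda>n. C * infnorm (U - V) * b ^ n) \<longlonglongrightarrow> 0"
      using b by (intro tendsto_mult_right_zero LIMSEQ_power_zero) auto
  qed
  \<comment> \<open>The increments are dominated by a geometric series and their partial sums
    telescope to the iterates from 0.\<close>
  have "summable (\<lambda>n. (F ^^ Suc n) 0 - (F ^^ n) 0)"
  proof (rule summable_comparison_test')
    show "summable (\<lambda>n. C * infnorm (F 0 - 0) * b ^ n)"
      using b by (intro summable_mult summable_geometric) auto
    show "norm ((F ^^ Suc n) 0 - (F ^^ n) 0) \<le> C * infnorm (F 0 - 0) * b ^ n" for n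
      using norm_le[of n "F 0" 0] by (simp add: funpow_swap1)
  qed
  moreover have "(\<Sum>i<n. (F ^^ Suc i) 0 - (F ^^ i) 0) = (F ^^ n) 0" for n
    using sum_lessThan_telescope[of "\<lambda>n. (F ^^ n) 0" n] by simp
  ultimately have "convergent (\<lambda>n. (F ^^ n) 0)"
    unfolding summable_iff_convergent by (simp only:)
  then obtain W where W0: "(\<lambda>n. (F ^^ n) 0) \<longlonglongrightarrow> W"
    unfolding convergent_def by blast
  have W: "(\<lambda>n. (F ^^ n) V) \<longlonglongrightarrow> W" for V
    using tendsto_add[OF W0 diff0[of V 0]] by simp
  \<comment> \<open>The Lipschitz constant \<open>C * b\<close> may exceed 1; it serves only to pass
    to the limit inside \<open>F\<close>.\<close>
  have "norm (F V - F U) \<le> C * b * norm (V - U)" for V U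
  proof -
    have "norm (F V - F U) \<le> C * b * infnorm (V - U)"
      using norm_le[of 1 V U] by (simp add: mult_ac)
    also have "\<dots> \<le> C * b * norm (V - U)"
      using b by (intro mult_left_mono infnorm_le_norm) (auto simp: C_def)
    finally show ?thesis .
  qed
  then have "\<forall>\<^sub>F n in sequentially. norm (F ((F ^^ n) 0) - F W) \<le> C * b * norm ((F ^^ n) 0 - W)"
    by simp
  moreover have "(\<lambda>n. C * b * norm ((F ^^ n) 0 - W)) \<longlonglongrightarrow> 0"
    using W0 by (intro tendsto_mult_right_zero tendsto_norm_zero LIM_zero)
  ultimately have "(\<lambda>n. F ((F ^^ n) 0) - F W) \<longlonglongrightarrow> 0"
    by (rule Lim_null_comparison)
  then have "(\<lambda>n. (F ^^ Suc n) 0) \<longlonglongrightarrow> F W"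
    by (simp add: LIM_zero_cancel)
  then have "F W = W"
    using LIMSEQ_Suc[OF W0] by (rule LIMSEQ_unique)
  with W show ?thesis
    using that by blast
qed

section \<open>Auxiliary facts on norms, finite maxima and filters\<close>

lemma infnorm_le_cart:
  fixes V :: "real ^ ('x::finite)"
  assumes "\<And>x. \<bar>V $ x\<bar> \<le> c"
  shows "infnorm V \<le> c"
  unfolding infnorm_cart using assms by (intro cSup_least) auto

lemma Max_image_le_add:
  fixes f g :: "'b \<Rightarrow> real"
  assumes "finite S" "S \<noteq> {}" "\<And>s. s \<in> S \<Longrightarrow> f s \<le> g s + c"
  shows "Max (f ` S) \<le> Max (g ` S) + c"
proof -
  have "f s \<le> Max (g ` S) + c" if "s \<in> S" for s
  proof -
    have "g s \<le> Max (g ` S)"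
      using that assms(1) by simp
    with assms(3)[OF that] show ?thesis by linarith
  qed
  with assms show ?thesis by simp
qed

lemma tendsto_Max_image:
  fixes f :: "'b \<Rightarrow> 'c \<Rightarrow> real"
  assumes "finite S" "S \<noteq> {}" "\<And>s. s \<in> S \<Longrightarrow> (f s \<longlongrightarrow> l s) F"
  shows "((\<lambda>\<beta>. Max ((\<lambda>s. f s \<beta>) ` S)) \<longlongrightarrow> Max (l ` S)) F"
  using assms
proof (induction S rule: finite_ne_induct)
  case (insert s S)
  then have "((\<lambda>\<beta>. max (f s \<beta>) (Max ((\<lambda>s. f s \<beta>) ` S))) \<longlongrightarrow> max (l s) (Max (l ` S))) F"
    by (intro tendsto_max) auto
  with insert.hyps show ?case by simp
qed simp

text \<open>Pigeonhole principle for filters: finitely many predicates that each fail eventually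
  also fail simultaneously, eventually.\<close>

lemma frequently_bex_finite:
  assumes "finite S" "\<exists>\<^sub>F x in F. \<exists>s\<in>S. P s x"
  shows "\<exists>s\<in>S. \<exists>\<^sub>F x in F. P s x"
  using assms eventually_ball_finite[of S "\<lambda>x s. \<not> P s x" F]
  unfolding frequently_def by auto

section \<open>One-step operators and the Bellman operator\<close>

definition bellman :: "('x::finite, 'a) mdp \<Rightarrow> real \<Rightarrow> real ^ 'x \<Rightarrow> real ^ 'x" where
  "bellman M \<beta> V = (\<chi> x. Max ((\<lambda>\<phi>. T_op M \<beta> \<phi> V $ x) ` decision_rules M))"

lemma fin_value_Suc: "fin_value M \<beta> (Suc n) = bellman M \<beta> (fin_value M \<beta> n)"
  by (simp add: bellman_def)

lemma fin_value_funpow: "fin_value M \<beta> n = (bellman M \<beta> ^^ n) (\<chi> x. terminal M x)"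
  by (induction n) (simp_all add: fin_value_Suc del: fin_value.simps(2))

lemma T_op_nth:
  "T_op M \<beta> \<phi> V $ x = reward M x (\<phi> x) + \<beta> * (\<Sum>y\<in>UNIV. trans M x (\<phi> x) y * V $ y)"
  by (simp add: T_op_def reward_vec_def trans_mat_def matrix_vector_mult_def)

lemma tendsto_T_op [tendsto_intros]:
  assumes "(b \<longlongrightarrow> \<beta>) F" "(v \<longlongrightarrow> V) F"
  shows "((\<lambda>z. T_op M (b z) \<phi> (v z)) \<longlongrightarrow> T_op M \<beta> \<phi> V) F"
  by (intro vec_tendstoI) (auto simp: T_op_nth intro!: tendsto_add tendsto_mult tendsto_sum
      tendsto_vec_nth assms)

locale fmdp =
  fixes M :: "('x::finite, 'a) mdp"
  assumes fin: "finite_mdp M"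
begin

lemma finite_decision_rules: "finite (decision_rules M)"
proof -
  have "decision_rules M = Pi\<^sub>E UNIV (actions M)"
    by (auto simp: decision_rules_def)
  then show ?thesis
    using fin by (simp add: finite_mdp_def finite_PiE)
qed

lemma decision_rules_nonempty: "decision_rules M \<noteq> {}"
proof -
  have "(\<lambda>x. SOME a. a \<in> actions M x) \<in> decision_rules M"
    using fin by (simp add: decision_rules_def finite_mdp_def some_in_eq)
  then show ?thesis by blast
qed

lemma T_op_le_bellman:
  assumes "\<phi> \<in> decision_rules M"
  shows "T_op M \<beta> \<phi> V $ x \<le> bellman M \<beta> V $ x"
  using assms finite_decision_rules by (simp add: bellman_def)

text \<open>The maximisers found at different states may differ, but the component at
  \<open>x\<close> sees a rule only through its action at \<open>x\<close>. Hence they can be glued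
  along the diagonal into one rule.\<close>

lemma bellman_attained:
  obtains \<phi> where "\<phi> \<in> decision_rules M" "bellman M \<beta> V = T_op M \<beta> \<phi> V"
proof -
  have "\<exists>\<psi>\<in>decision_rules M. bellman M \<beta> V $ x = T_op M \<beta> \<psi> V $ x" for x
    using Max_in[of "(\<lambda>\<phi>. T_op M \<beta> \<phi> V $ x) ` decision_rules M"]
      finite_decision_rules decision_rules_nonempty
    unfolding bellman_def by (simp add: image_iff)
  then obtain \<psi> where \<psi>: "\<And>x. \<psi> x \<in> decision_rules M"
    "\<And>x. bellman M \<beta> V $ x = T_op M \<beta> (\<psi> x) V $ x"
    by metis
  show ?thesis
  proof
    show "(\<lambda>x. \<psi> x x) \<in> decision_rules M"
      using \<psi>(1) by (simp add: decision_rules_def)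
    show "bellman M \<beta> V = T_op M \<beta> (\<lambda>x. \<psi> x x) V"
      using \<psi>(2) by (simp add: vec_eq_iff T_op_nth)
  qed
qed

text \<open>The rewards cancel, and a row of a stochastic matrix averages the components of
  \<open>U - V\<close>.\<close>

lemma T_op_diff_le:
  assumes "\<phi> \<in> decision_rules M" "0 \<le> \<beta>"
  shows "\<bar>T_op M \<beta> \<phi> U $ x - T_op M \<beta> \<phi> V $ x\<bar> \<le> \<beta> * infnorm (U - V)"
proof -
  have p: "0 \<le> trans M x (\<phi> x) y" "(\<Sum>y\<in>UNIV. trans M x (\<phi> x) y) = 1" for y
    using fin assms(1) by (auto simp: finite_mdp_def decision_rules_def)
  have "T_op M \<beta> \<phi> U $ x - T_op M \<beta> \<phi> V $ x
      = \<beta> * (\<Sum>y\<in>UNIV. trans M x (\<phi> x) y * (U - V) $ y)"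
    by (simp add: T_op_nth algebra_simps sum_subtractf)
  moreover have "\<bar>\<Sum>y\<in>UNIV. trans M x (\<phi> x) y * (U - V) $ y\<bar>
      \<le> (\<Sum>y\<in>UNIV. trans M x (\<phi> x) y * infnorm (U - V))"
    using p component_le_infnorm_cart[of "U - V"]
    by (intro sum_abs[THEN order_trans] sum_mono) (simp add: abs_mult mult_left_mono)
  moreover have "\<dots> = infnorm (U - V)"
    using p(2) by (simp flip: sum_distrib_right)
  ultimately show ?thesis
    using assms(2) by (simp add: abs_mult mult_left_mono)
qed

lemma T_op_mono:
  assumes "\<phi> \<in> decision_rules M" "0 \<le> \<beta>" "\<And>y. U $ y \<le> V $ y"
  shows "T_op M \<beta> \<phi> U $ x \<le> T_op M \<beta> \<phi> V $ x"
  using fin assms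
  by (auto simp: T_op_nth finite_mdp_def decision_rules_def intro!: mult_left_mono sum_mono)

lemma bellman_contraction:
  assumes "0 \<le> \<beta>"
  shows "infnorm (bellman M \<beta> U - bellman M \<beta> V) \<le> \<beta> * infnorm (U - V)"
proof (rule infnorm_le_cart)
  fix x
  \<comment> \<open>A one-sided bound passes through the maximum; exchanging \<open>U\<close> and
    \<open>V\<close> gives the absolute value.\<close>
  have "bellman M \<beta> U $ x \<le> bellman M \<beta> V $ x + \<beta> * infnorm (U - V)" for U V
    unfolding bellman_def vec_lambda_beta
    using T_op_diff_le[OF _ assms, of _ U x V] finite_decision_rules decision_rules_nonempty
    by (intro Max_image_le_add) (auto simp: abs_le_iff algebra_simps)
  from this[of U V] this[of V U]
  show "\<bar>(bellman M \<beta> U - bellman M \<beta> V) $ x\<bar> \<le> \<beta> * infnorm (U - V)"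
    by (simp add: abs_le_iff infnorm_sub algebra_simps)
qed

section \<open>Policy values and the optimal value as fixed points\<close>

lemma T_op_funpow_zero:
  "(T_op M \<beta> \<phi> ^^ n) 0 = (\<Sum>t<n. \<beta> ^ t *\<^sub>R (mat_pow (trans_mat M \<phi>) t *v reward_vec M \<phi>))"
proof (induction n)
  case (Suc n)
  let ?s = "\<lambda>n. \<Sum>t<n. \<beta> ^ t *\<^sub>R (mat_pow (trans_mat M \<phi>) t *v reward_vec M \<phi>)"
  have "trans_mat M \<phi> *v ?s n
      = (\<Sum>t<n. \<beta> ^ t *\<^sub>R (mat_pow (trans_mat M \<phi>) (Suc t) *v reward_vec M \<phi>))"
    by (simp add: linear_sum[OF matrix_vector_mul_linear] o_def matrix_vector_mult_scaleR
        flip: matrix_vector_mul_assoc)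
  then have "T_op M \<beta> \<phi> (?s n) = ?s (Suc n)"
    unfolding T_op_def sum.lessThan_Suc_shift by (simp add: scaleR_sum_right)
  with Suc show ?case by simp
qed simp

text \<open>The iterates converge to one limit from every start. From 0 they are the partial sums of
  the series in \<open>policy_value\<close>, which identifies that limit.\<close>

lemma T_op_funpow_tendsto:
  assumes "\<phi> \<in> decision_rules M" "0 \<le> \<beta>" "\<beta> < 1"
  shows "(\<lambda>n. (T_op M \<beta> \<phi> ^^ n) V) \<longlonglongrightarrow> policy_value M \<beta> \<phi>"
proof -
  have "infnorm (T_op M \<beta> \<phi> U - T_op M \<beta> \<phi> V) \<le> \<beta> * infnorm (U - V)" for U V
    using T_op_diff_le[OF assms(1,2)] by (intro infnorm_le_cart) simp
  then obtain W where W: "\<And>V. (\<lambda>n. (T_op M \<beta> \<phi> ^^ n) V) \<longlonglongrightarrow> W"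
    by (rule contraction_infnorm_fixpoint[OF assms(2,3)]) blast
  have "(\<lambda>t. \<beta> ^ t *\<^sub>R (mat_pow (trans_mat M \<phi>) t *v reward_vec M \<phi>)) sums W"
    using W[of 0] unfolding sums_def T_op_funpow_zero .
  then have W_eq: "policy_value M \<beta> \<phi> = W"
    unfolding policy_value_def by (rule sums_unique[symmetric])
  show "(\<lambda>n. (T_op M \<beta> \<phi> ^^ n) V) \<longlonglongrightarrow> policy_value M \<beta> \<phi>"
    unfolding W_eq by (rule W)
qed

lemma policy_value_unique:
  assumes "\<phi> \<in> decision_rules M" "0 \<le> \<beta>" "\<beta> < 1" "T_op M \<beta> \<phi> V = V"
  shows "policy_value M \<beta> \<phi> = V"
proof -
  have "(T_op M \<beta> \<phi> ^^ n) V = V" for n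
    by (induction n) (simp_all add: assms(4))
  then show ?thesis
    using T_op_funpow_tendsto[OF assms(1-3), of V] by (simp add: LIMSEQ_const_iff)
qed

text \<open>No policy value exceeds \<open>W\<close>: by monotonicity the iterates of
  \<open>T_op\<close> from \<open>W\<close> stay below \<open>W\<close>. A rule attaining the
  Bellman maximum at \<open>W\<close> has value exactly \<open>W\<close>, so it is optimal at all
  states at once.\<close>

lemma opt_value_unique:
  assumes \<beta>: "0 \<le> \<beta>" "\<beta> < 1" and W: "bellman M \<beta> W = W"
  shows "opt_value M \<beta> = W"
proof -
  have "policy_value M \<beta> \<phi> $ x \<le> W $ x" if \<phi>: "\<phi> \<in> decision_rules M" for \<phi> x
  proof -
    have "(T_op M \<beta> \<phi> ^^ n) W $ x \<le> W $ x" for n x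
    proof (induction n arbitrary: x)
      case (Suc n)
      have "(T_op M \<beta> \<phi> ^^ Suc n) W $ x \<le> T_op M \<beta> \<phi> W $ x"
        using T_op_mono[OF \<phi> \<beta>(1) Suc] by simp
      also have "\<dots> \<le> W $ x"
        using T_op_le_bellman[OF \<phi>, of \<beta> W x] by (simp add: W)
      finally show ?case .
    qed simp
    then show ?thesis
      by (intro LIMSEQ_le_const2[OF tendsto_vec_nth[OF T_op_funpow_tendsto[OF \<phi> \<beta>, of W]]]) auto
  qed
  moreover obtain \<psi> where "\<psi> \<in> decision_rules M" "policy_value M \<beta> \<psi> = W"
    using bellman_attained[of \<beta> W] policy_value_unique[OF _ \<beta>] W by metis
  ultimately show ?thesis
    using finite_decision_rules
    by (auto simp: opt_value_def vec_eq_iff intro!: Max_eqI image_eqI[of _ _ \<psi>])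
qed

section \<open>Value iteration and the turnpike integer\<close>

lemma fin_value_tendsto_opt_value:
  assumes \<beta>: "0 \<le> \<beta>" "\<beta> < 1"
  shows "(\<lambda>n. fin_value M \<beta> n) \<longlonglongrightarrow> opt_value M \<beta>"
proof -
  obtain W where W: "bellman M \<beta> W = W" "\<And>V. (\<lambda>n. (bellman M \<beta> ^^ n) V) \<longlonglongrightarrow> W"
    by (rule contraction_infnorm_fixpoint[OF \<beta> bellman_contraction[OF \<beta>(1)]]) blast
  with opt_value_unique[OF \<beta> W(1)]
  show ?thesis
    by (simp add: fin_value_funpow)
qed

text \<open>A rule that is not optimal leaves a nonzero residual at \<open>opt_value\<close>. The
  residuals along value iteration converge to it, so they are eventually nonzero; finiteness of the
  set of rules makes the threshold uniform.\<close>

lemma turnpike_exists: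
  assumes \<beta>: "0 \<le> \<beta>" "\<beta> < 1"
  shows "\<exists>N\<ge>1. \<forall>n\<ge>N. D_fin M n \<beta> \<subseteq> D_opt M \<beta>"
proof -
  have "\<forall>\<^sub>F n in sequentially. \<phi> \<notin> D_fin M (Suc n) \<beta>"
    if \<phi>: "\<phi> \<in> decision_rules M - D_opt M \<beta>" for \<phi>
  proof -
    have "(\<lambda>n. fin_value M \<beta> (Suc n) - T_op M \<beta> \<phi> (fin_value M \<beta> n))
        \<longlonglongrightarrow> opt_value M \<beta> - T_op M \<beta> \<phi> (opt_value M \<beta>)"
      using fin_value_tendsto_opt_value[OF \<beta>]
      by (intro tendsto_intros LIMSEQ_Suc)
    moreover have "opt_value M \<beta> - T_op M \<beta> \<phi> (opt_value M \<beta>) \<noteq> 0"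
      using \<phi> policy_value_unique[OF _ \<beta>, of \<phi> "opt_value M \<beta>"] by (auto simp: D_opt_def)
    ultimately have "\<forall>\<^sub>F n in sequentially.
        fin_value M \<beta> (Suc n) - T_op M \<beta> \<phi> (fin_value M \<beta> n) \<noteq> 0"
      by (rule tendsto_imp_eventually_ne)
    then show ?thesis
      by eventually_elim (simp add: D_fin_def del: fin_value.simps)
  qed
  then have "\<forall>\<^sub>F n in sequentially. \<forall>\<phi>\<in>decision_rules M - D_opt M \<beta>. \<phi> \<notin> D_fin M (Suc n) \<beta>"
    using finite_decision_rules by (intro eventually_ball_finite) auto
  then obtain N where N:
    "\<And>n \<phi>. N \<le> n \<Longrightarrow> \<phi> \<in> decision_rules M - D_opt M \<beta> \<Longrightarrow> \<phi> \<notin> D_fin M (Suc n) \<beta>"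
    unfolding eventually_sequentially by blast
  \<comment> \<open>Passing from stage \<open>Suc n\<close> back to stage \<open>n\<close> raises
    the threshold to \<open>Suc N\<close>, which is also at least 1.\<close>
  have "D_fin M n \<beta> \<subseteq> D_opt M \<beta>" if "Suc N \<le> n" for n
  proof
    fix \<phi> assume \<phi>: "\<phi> \<in> D_fin M n \<beta>"
    then have "\<phi> \<in> decision_rules M"
      by (simp add: D_fin_def)
    moreover have "N \<le> n - 1" "Suc (n - 1) = n"
      using that by simp_all
    ultimately show "\<phi> \<in> D_opt M \<beta>"
      using N[of "n - 1" \<phi>] \<phi> by auto
  qed
  then show ?thesis
    by (intro exI[of _ "Suc N"]) auto
qed

text \<open>\<open>turnpike\<close> is a \<open>LEAST\<close>, so its defining property becomes
  available only through the witness from \<open>turnpike_exists\<close>.\<close>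

lemma D_fin_subset_D_opt:
  assumes "0 \<le> \<beta>" "\<beta> < 1" "turnpike M \<beta> \<le> n"
  shows "D_fin M n \<beta> \<subseteq> D_opt M \<beta>"
  using LeastI_ex[OF turnpike_exists[OF assms(1,2)]] assms(3)
  unfolding turnpike_def by blast

lemma D_fin_nonempty:
  assumes "1 \<le> n"
  shows "\<exists>\<phi>\<in>decision_rules M. \<phi> \<in> D_fin M n \<beta>"
proof -
  obtain \<phi> where "\<phi> \<in> decision_rules M"
    "bellman M \<beta> (fin_value M \<beta> (n - 1)) = T_op M \<beta> \<phi> (fin_value M \<beta> (n - 1))"
    by (rule bellman_attained)
  with assms show ?thesis
    using fin_value_Suc[of M \<beta> "n - 1"] by (auto simp: D_fin_def)
qed

section \<open>Continuity in the discount factor and recurring rules\<close>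

lemma tendsto_fin_value:
  assumes "F \<le> nhds \<alpha>"
  shows "((\<lambda>\<beta>. fin_value M \<beta> n) \<longlongrightarrow> fin_value M \<alpha> n) F"
proof (induction n)
  case (Suc n)
  have "((\<lambda>\<beta>. \<beta>) \<longlongrightarrow> \<alpha>) F"
    using assms by (simp add: filterlim_def)
  with Suc show ?case
    using finite_decision_rules decision_rules_nonempty
    by (intro vec_tendstoI)
      (auto intro!: tendsto_Max_image tendsto_vec_nth[OF tendsto_T_op])
qed simp

text \<open>A general filter \<open>F\<close> covers approach from the left and from the right
  together. The rule may change with \<open>n\<close>, while \<open>K\<close> is fixed.\<close>

lemma recurring_decision_rule:
  assumes F: "F \<le> nhds \<alpha>" and range: "\<forall>\<^sub>F \<beta> in F. \<beta> \<in> {0..<1}"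
    and Lim: "Liminf F (\<lambda>\<beta>. enat (turnpike M \<beta>)) < \<infinity>"
  shows "\<exists>K\<ge>1. \<forall>n\<ge>K. \<exists>\<phi>\<in>D_fin M n \<alpha>. \<exists>\<^sub>F \<beta> in F. \<phi> \<in> D_opt M \<beta>"
proof -
  obtain N where N: "Liminf F (\<lambda>\<beta>. enat (turnpike M \<beta>)) = enat N"
    using Lim by auto
  \<comment> \<open>By integrality, eventually exceeding \<open>N\<close> means being eventually at
    least \<open>Suc N\<close>, which would lift the lower limit above \<open>N\<close>.\<close>
  have freq: "\<exists>\<^sub>F \<beta> in F. turnpike M \<beta> \<le> N"
  proof (rule ccontr)
    assume "\<not> (\<exists>\<^sub>F \<beta> in F. turnpike M \<beta> \<le> N)"
    then have "\<forall>\<^sub>F \<beta> in F. enat (Suc N) \<le> enat (turnpike M \<beta>)"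
      by (simp add: frequently_def not_le Suc_le_eq)
    then have "enat (Suc N) \<le> enat N"
      unfolding N[symmetric] by (rule Liminf_bounded)
    then show False by simp
  qed
  \<comment> \<open>Starting at \<open>Suc N\<close> instead of \<open>N\<close> guarantees a stage
    \<open>n\<close> of at least 1, where \<open>D_fin_nonempty\<close> applies.\<close>
  have "\<exists>\<phi>\<in>D_fin M n \<alpha>. \<exists>\<^sub>F \<beta> in F. \<phi> \<in> D_opt M \<beta>" if n: "Suc N \<le> n" for n
  proof -
    have "\<exists>\<^sub>F \<beta> in F. \<exists>\<phi>\<in>decision_rules M. \<phi> \<in> D_fin M n \<beta> \<and> \<phi> \<in> D_opt M \<beta>"
      using frequently_eventually_frequently[OF freq range]
    proof (rule frequently_elim1)
      fix \<beta> assume "turnpike M \<beta> \<le> N \<and> \<beta> \<in> {0..<1}"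
      with n D_fin_subset_D_opt[of \<beta> n] D_fin_nonempty[of n \<beta>]
      show "\<exists>\<phi>\<in>decision_rules M. \<phi> \<in> D_fin M n \<beta> \<and> \<phi> \<in> D_opt M \<beta>"
        by fastforce
    qed
    from frequently_bex_finite[OF finite_decision_rules this]
    obtain \<phi> where \<phi>: "\<phi> \<in> decision_rules M" "\<exists>\<^sub>F \<beta> in F. \<phi> \<in> D_fin M n \<beta> \<and> \<phi> \<in> D_opt M \<beta>"
      by blast
    \<comment> \<open>A nonzero residual at \<alpha> would by continuity stay nonzero eventually
      along \<open>F\<close>, against the recurrence of \<open>\<phi>\<close>.\<close>
    have "\<phi> \<in> D_fin M n \<alpha>"
    proof (rule ccontr)
      assume "\<phi> \<notin> D_fin M n \<alpha>"
      then have "fin_value M \<alpha> n - T_op M \<alpha> \<phi> (fin_value M \<alpha> (n - 1)) \<noteq> 0"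
        using \<phi>(1) by (simp add: D_fin_def)
      moreover have "((\<lambda>\<beta>. fin_value M \<beta> n - T_op M \<beta> \<phi> (fin_value M \<beta> (n - 1)))
          \<longlongrightarrow> fin_value M \<alpha> n - T_op M \<alpha> \<phi> (fin_value M \<alpha> (n - 1))) F"
        using F by (intro tendsto_intros tendsto_fin_value) (auto simp: filterlim_def)
      ultimately have "\<forall>\<^sub>F \<beta> in F.
          fin_value M \<beta> n - T_op M \<beta> \<phi> (fin_value M \<beta> (n - 1)) \<noteq> 0"
        by (rule tendsto_imp_eventually_ne[rotated])
      then have "\<forall>\<^sub>F \<beta> in F. \<not> (\<phi> \<in> D_fin M n \<beta> \<and> \<phi> \<in> D_opt M \<beta>)"
        by eventually_elim (simp add: D_fin_def)
      with \<phi>(2) show False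
        by (simp add: frequently_def)
    qed
    moreover have "\<exists>\<^sub>F \<beta> in F. \<phi> \<in> D_opt M \<beta>"
      using \<phi>(2) by (rule frequently_elim1) simp
    ultimately show ?thesis by blast
  qed
  then show ?thesis
    by (intro exI[of _ "Suc N"]) auto
qed

end

section \<open>Passage to the one-sided limit sets\<close>

lemma frequently_D_opt_imp_D_set:
  assumes "\<exists>\<^sub>F \<beta> in F. \<phi> \<in> D_opt M \<beta>" "\<forall>\<^sub>F \<beta> in F. \<beta> \<in> E"
  shows "\<phi> \<in> D_set M E"
  using frequently_ex[OF frequently_eventually_frequently[OF assms]]
  by (auto simp: D_set_def)

theorem theorem5p3:
  fixes M :: "('x::finite, 'a) mdp" and \<alpha> :: real
  assumes "finite_mdp M" and "0 < \<alpha>" and "\<alpha> < 1" and "irregular_point M \<alpha>"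
  shows "(Liminf (at_left \<alpha>) (\<lambda>\<beta>. enat (turnpike M \<beta>)) < \<infinity> \<longrightarrow>
            (\<exists>K\<ge>1. \<forall>n\<ge>K. D_fin M n \<alpha> \<inter> D_left M \<alpha> \<noteq> {}))
       \<and> (Liminf (at_right \<alpha>) (\<lambda>\<beta>. enat (turnpike M \<beta>)) < \<infinity> \<longrightarrow>
            (\<exists>K\<ge>1. \<forall>n\<ge>K. D_fin M n \<alpha> \<inter> D_right M \<alpha> \<noteq> {}))"
proof -
  interpret fmdp M
    by standard (rule assms(1))
  have left: "\<forall>\<^sub>F \<beta> in at_left \<alpha>. \<beta> \<in> {\<alpha> - e <..< \<alpha>} \<inter> {0..<1}" if "0 < e" for e
    using eventually_at_left_real[of "max 0 (\<alpha> - e)" \<alpha>] that assms(2,3)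
    by (auto elim!: eventually_mono)
  have right: "\<forall>\<^sub>F \<beta> in at_right \<alpha>. \<beta> \<in> {\<alpha> <..< \<alpha> + e} \<inter> {0..<1}" if "0 < e" for e
    using eventually_at_right_real[of \<alpha> "min 1 (\<alpha> + e)"] that assms(2,3)
    by (auto elim!: eventually_mono)
  have nhds: "at_left \<alpha> \<le> nhds \<alpha>" "at_right \<alpha> \<le> nhds \<alpha>"
    by (simp_all add: at_within_def)
  \<comment> \<open>Each interval of length \<open>1 / real i\<close> in the definition eventually
    contains \<beta>, so a recurring rule is optimal somewhere in each of them.\<close>
  have "\<phi> \<in> D_left M \<alpha>" if "\<exists>\<^sub>F \<beta> in at_left \<alpha>. \<phi> \<in> D_opt M \<beta>" for \<phi>
    unfolding D_left_def using that left by (auto intro!: frequently_D_opt_imp_D_set)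
  moreover have "\<phi> \<in> D_right M \<alpha>" if "\<exists>\<^sub>F \<beta> in at_right \<alpha>. \<phi> \<in> D_opt M \<beta>" for \<phi>
    unfolding D_right_def using that right by (auto intro!: frequently_D_opt_imp_D_set)
  moreover have "\<forall>\<^sub>F \<beta> in at_left \<alpha>. \<beta> \<in> {0..<1}" "\<forall>\<^sub>F \<beta> in at_right \<alpha>. \<beta> \<in> {0..<1}"
    using left[of 1] right[of 1] by (auto elim!: eventually_mono)
  ultimately show ?thesis
    using recurring_decision_rule[OF nhds(1)] recurring_decision_rule[OF nhds(2)] by blast
qed

end
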